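(* Let $m\ge 1$, let $a_1<\cdots<a_m$ be $m$ primary colors, and let $u_1,\dots,u_m,n$ be non-negative integers. Let $\mathcal{C}(u_1,\dots,u_m,n)$ be the set of partitions of $n$ into parts colored by primary colors, with exactly $u_k$ parts of color $a_k$ for each $k$, the parts of the same color being distinct. Let $\mathcal{D}(u_1,\dots,u_m,n)$ be the set of partitions $\lambda_1+\cdots+\lambda_s$ of $n$ into parts colored by primary and secondary colors, such that $\lambda_1\gg_c\lambda_2\gg_c\cdots\gg_c\lambda_s$, no part is equal to $1_{a_ia_j}$ for any $i,j$ (that is, no part with a secondary color has size $1$), and for each $i$ the number $u_i$ equals the number of parts colored by $a_i$, $a_ia_j$ or $a_ja_i$ with $j\neq i$, plus twice the number of parts colored by $a_i^2=a_ia_i$. Then $$\sharp\,\mathcal{C}(u_1,\dots,u_m,n)=\sharp\,\mathcal{D}(u_1,\dots,u_m,n).$$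
   Context: Write $\chi(A)=1$ if the statement $A$ is true and $\chi(A)=0$ otherwise. The set of primary colors is $\{a_1,\dots,a_m\}$, totally ordered by $a_1<\cdots<a_m$. There are $m^2$ secondary colors $a_ia_j$, $i,j\in\{1,\dots,m\}$; $a_ia_j$ and $a_ja_i$ are different colors when $i\ne j$. A colored part is a positive integer (its size) together with a color, written $k_p$ (size $k$, primary color $p$) or $k_{pq}$ (size $k$, secondary color $pq$); the secondary color $pq$ may only color sizes $k$ having the same parity as $\chi(p\le q)$. A partition of $n$ into colored parts is a finite collection of colored parts whose sizes add up to $n$. The relation $\gg_c$ on colored parts is defined as follows, for primary colors $p,q,r,t$ and sizes $k,l$ (the actual sizes of the parts, of the allowed parity when the color is secondary): - $k_p\gg_c l_q \iff k-l\ge 1+\chi(p\le q)$; - $k_p\gg_c l_{qr}\iff k-l\ge \chi(p\le q)+\chi(q\le r)$; - $k_{pq}\gg_c l_r\iff k-l\ge 1+\chi(p\le q)+\chi(q\le r)$; - $k_{pq}\gg_c l_{rt}\iff k-l\ge \chi(p\le q)+2\chi(q\le r)+\chi(r\le t)$. *)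

theory Defs
  imports "HOL-Library.Multiset"
begin

(* The primary colors a_1 < ... < a_m are represented by their indices 1, ..., m, so that their
   order is the order of the indices.  The indicator chi(A) is written of_bool A. *)

datatype color = Primary nat | Secondary nat nat

(* size and color *)
type_synonym colored_part = "nat \<times> color"

fun color_over :: "nat \<Rightarrow> color \<Rightarrow> bool" where
  "color_over m (Primary p) \<longleftrightarrow> p \<in> {1..m}"
| "color_over m (Secondary p q) \<longleftrightarrow> p \<in> {1..m} \<and> q \<in> {1..m}"

fun parity_ok :: "colored_part \<Rightarrow> bool" where
  "parity_ok (k, Primary p) \<longleftrightarrow> True"
| "parity_ok (k, Secondary p q) \<longleftrightarrow> k mod 2 = of_bool (p \<le> q)"

definition is_colored_part :: "nat \<Rightarrow> colored_part \<Rightarrow> bool" where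
  "is_colored_part m x \<longleftrightarrow> fst x \<ge> 1 \<and> color_over m (snd x) \<and> parity_ok x"

definition is_partition :: "nat \<Rightarrow> nat \<Rightarrow> colored_part multiset \<Rightarrow> bool" where
  "is_partition m n M \<longleftrightarrow> (\<forall>x\<in>#M. is_colored_part m x) \<and> (\<Sum>x\<in>#M. fst x) = n"

(* The differences of sizes are taken in the integers: they may be negative. *)
fun gg_c :: "colored_part \<Rightarrow> colored_part \<Rightarrow> bool"  (infix "\<ggreater>\<^sub>c" 50) where
  "(k, Primary p) \<ggreater>\<^sub>c (l, Primary q) \<longleftrightarrow>
     int k - int l \<ge> 1 + of_bool (p \<le> q)"
| "(k, Primary p) \<ggreater>\<^sub>c (l, Secondary q r) \<longleftrightarrow>
     int k - int l \<ge> of_bool (p \<le> q) + of_bool (q \<le> r)"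
| "(k, Secondary p q) \<ggreater>\<^sub>c (l, Primary r) \<longleftrightarrow>
     int k - int l \<ge> 1 + of_bool (p \<le> q) + of_bool (q \<le> r)"
| "(k, Secondary p q) \<ggreater>\<^sub>c (l, Secondary r t) \<longleftrightarrow>
     int k - int l \<ge> of_bool (p \<le> q) + 2 * of_bool (q \<le> r) + of_bool (r \<le> t)"

definition num_parts :: "colored_part multiset \<Rightarrow> color set \<Rightarrow> nat" where
  "num_parts M S = size {#x \<in># M. snd x \<in> S#}"

definition C_partitions :: "nat \<Rightarrow> (nat \<Rightarrow> nat) \<Rightarrow> nat \<Rightarrow> colored_part multiset set" where
  "C_partitions m u n =
     {M. is_partition m n M
       \<and> (\<forall>x\<in>#M. snd x \<in> range Primary)
       \<and> (\<forall>i\<in>{1..m}. num_parts M {Primary i} = u i)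
       \<and> (\<forall>x. count M x \<le> 1)}"

(* A partition is a multiset of parts; it satisfies the difference conditions if its parts can be
   listed as a chain for gg_c, the condition being imposed on consecutive parts only. *)
definition D_partitions :: "nat \<Rightarrow> (nat \<Rightarrow> nat) \<Rightarrow> nat \<Rightarrow> colored_part multiset set" where
  "D_partitions m u n =
     {M. is_partition m n M
       \<and> (\<exists>xs. mset xs = M \<and> successively (\<ggreater>\<^sub>c) xs)
       \<and> (\<forall>i\<in>{1..m}. \<forall>j\<in>{1..m}. (1, Secondary i j) \<notin># M)
       \<and> (\<forall>i\<in>{1..m}. u i =
            num_parts M ({Primary i} \<union> {Secondary i j | j. j \<in> {1..m} \<and> j \<noteq> i}
                                     \<union> {Secondary j i | j. j \<in> {1..m} \<and> j \<noteq> i})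
            + 2 * num_parts M {Secondary i i})}"

lemma finite_partitions: "finite {M. is_partition m n M}"
proof -
  define A where "A = {1..n} \<times> {c. color_over m c}"
  have "{c. color_over m c} \<subseteq> Primary ` {1..m} \<union> case_prod Secondary ` ({1..m} \<times> {1..m})"
  proof
    fix c assume "c \<in> {c. color_over m c}"
    then show "c \<in> Primary ` {1..m} \<union> case_prod Secondary ` ({1..m} \<times> {1..m})"
      by (cases c) auto
  qed
  then have "finite {c. color_over m c}"
    by (rule finite_subset) auto
  then have fin: "finite {xs. set xs \<subseteq> A \<and> length xs \<le> n}"
    by (intro finite_lists_length_le) (simp add: A_def)
  have "{M. is_partition m n M} \<subseteq> mset ` {xs. set xs \<subseteq> A \<and> length xs \<le> n}"
  proof
    fix M assume "M \<in> {M. is_partition m n M}"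
    then have parts: "\<And>x. x \<in># M \<Longrightarrow> fst x \<ge> 1 \<and> color_over m (snd x)"
      and sum: "(\<Sum>x\<in>#M. fst x) = n"
      by (auto simp: is_partition_def is_colored_part_def)
    have "size M = (\<Sum>x\<in>#M. 1)"
      by simp
    also have "\<dots> \<le> (\<Sum>x\<in>#M. fst x)"
      by (rule sum_mset_mono) (use parts in auto)
    finally have size: "size M \<le> n"
      using sum by simp
    have le: "fst x \<le> n" if "x \<in># M" for x
      using sum multi_member_split[OF that] by auto
    obtain xs where xs: "mset xs = M"
      using ex_mset by blast
    have "set xs \<subseteq> A"
      using parts le xs by (force simp: A_def)
    moreover have "length xs \<le> n"
      using size xs by auto
    ultimately show "M \<in> mset ` {xs. set xs \<subseteq> A \<and> length xs \<le> n}"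
      using xs by auto
  qed
  then show ?thesis
    using fin by (meson finite_imageI finite_subset)
qed

lemma finite_C_partitions: "finite (C_partitions m u n)"
  by (rule finite_subset[OF _ finite_partitions[of m n]]) (auto simp: C_partitions_def)

lemma finite_D_partitions: "finite (D_partitions m u n)"
  by (rule finite_subset[OF _ finite_partitions[of m n]]) (auto simp: D_partitions_def)

end

theory Submission
  imports Defs "HOL-Library.Product_Lexorder"
begin

text \<open>
  Both sets are cut up according to the word of primary colors obtained by reading the parts in the
  order of the chain, a secondary color \<open>a\<^sub>pa\<^sub>q\<close> contributing the two letters \<open>p q\<close>.  For
  each word \<open>w\<close> of length \<open>s\<close> there are as many partitions of \<open>n\<close> of one kind as of the other.

  Call a position \<open>j\<close> of \<open>w\<close> a weak ascent if \<open>w\<^sub>j \<le> w\<^sub>j\<^sub>+\<^sub>1\<close>, and let \<open>A\<^sub>j\<close> be the number of weak ascents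
  at positions \<open>\<ge> j\<close>.  From a primary part at position \<open>j\<close> subtract \<open>A\<^sub>j\<close>; from a secondary part at
  positions \<open>j, j + 1\<close> subtract \<open>A\<^sub>j + A\<^sub>j\<^sub>+\<^sub>1\<close>, which leaves an even number by the parity condition.
  The total amount subtracted depends on \<open>w\<close> only.  Write \<open>x\<close> for the remainders of the primary parts
  and \<open>2v\<close> for those of the secondary parts.

  On primary-colored partitions with distinct parts, listed in the lexicographic order of the pairs
  (size, color), this gives all weakly decreasing sequences of \<open>s\<close> positive integers.

  On chains for \<open>\<ggreater>\<^sub>c\<close>, two consecutive primary parts must have \<open>x > x'\<close> and two consecutive secondary
  parts \<open>v \<ge> v'\<close>.  If the parts starting at position \<open>j\<close> are a primary and a secondary one, then the
  condition is \<open>x \<ge> 2v + A\<^sub>j\<^sub>+\<^sub>1\<close>; if they are a secondary and a primary one, it is the complementary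
  \<open>x < 2v + A\<^sub>j\<^sub>+\<^sub>1\<close>.  Thus exactly one of the two orders is allowed.  Moreover, the truth value of
  \<open>x \<ge> 2v + A\<^sub>j\<^sub>+\<^sub>1\<close> is monotone along both sequences, so that a strictly decreasing sequence of \<open>x\<close> and
  a weakly decreasing sequence of \<open>v\<close> can be interleaved in exactly one way.  Hence the chains with
  word \<open>w\<close> correspond to all pairs of such sequences, of lengths \<open>t\<close> and \<open>d\<close> with \<open>t + 2d = s\<close>
  (lemmas \<open>chain_interleave\<close> and \<open>chain_eq_interleave\<close>).  Positivity of the \<open>x\<close> and \<open>v\<close>
  matches the positivity of the parts and the absence of secondary parts of size \<open>1\<close>.

  Finally, a multiset \<open>N\<close> of \<open>s\<close> positive integers decomposes uniquely as \<open>X + V + V\<close> with \<open>X\<close> free of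
  repetitions (by the parity of the multiplicities), and this is a pair of sequences as above with the
  same sum.
\<close>

section \<open>Words of colors and their ascents\<close>

text \<open>The number of weak ascents of a word.\<close>
fun ascents :: "nat list \<Rightarrow> nat" where
  "ascents (p # q # w) = of_bool (p \<le> q) + ascents (q # w)"
| "ascents _ = 0"

text \<open>The sum of the numbers of weak ascents of all suffixes of a word: the total amount that is
  subtracted from the sizes of the parts.\<close>
fun ascent_weight :: "nat list \<Rightarrow> nat" where
  "ascent_weight [] = 0"
| "ascent_weight (p # w) = ascents (p # w) + ascent_weight w"

fun color_word :: "color \<Rightarrow> nat list" where
  "color_word (Primary p) = [p]"
| "color_word (Secondary p q) = [p, q]"

text \<open>The word of primary colors read off a list of colored parts.\<close>
definition word :: "colored_part list \<Rightarrow> nat list" where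
  "word ps = concat (map (color_word \<circ> snd) ps)"

section \<open>Interleaving two sequences along a word\<close>

text \<open>The list of parts with color word \<open>w\<close> whose primary parts have the remainders \<open>xs\<close> and whose
  secondary parts have the remainders \<open>2v\<close> for \<open>v\<close> in \<open>vs\<close>.  At each step the next part is primary
  iff this is compatible with the condition that \<open>\<ggreater>\<^sub>c\<close> imposes between the next \<open>x\<close> and the next \<open>v\<close>,
  where \<open>ascents (tl w)\<close> counts the ascents from the position after the current one.  The values are
  meaningful only if \<open>w\<close> has length \<open>length xs + 2 * length vs\<close>.\<close>
fun interleave :: "nat list \<Rightarrow> nat list \<Rightarrow> nat list \<Rightarrow> colored_part list" where
  "interleave w [] [] = []"
| "interleave w (x # xs) [] =
     (x + ascents w, Primary (hd w)) # interleave (tl w) xs []"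
| "interleave w [] (v # vs) =
     (2 * v + ascents w + ascents (tl w), Secondary (hd w) (hd (tl w)))
       # interleave (tl (tl w)) [] vs"
| "interleave w (x # xs) (v # vs) =
     (if 2 * v + ascents (tl w) \<le> x
      then (x + ascents w, Primary (hd w)) # interleave (tl w) xs (v # vs)
      else (2 * v + ascents w + ascents (tl w), Secondary (hd w) (hd (tl w)))
             # interleave (tl (tl w)) (x # xs) vs)"

text \<open>The functions \<open>singles\<close> and \<open>halves\<close> recover \<open>xs\<close> and \<open>vs\<close> from the list of parts, which makes
  \<open>interleave\<close> injective.\<close>
fun singles :: "colored_part list \<Rightarrow> nat list" where
  "singles [] = []"
| "singles ((k, Primary p) # ps) = (k - ascents (p # word ps)) # singles ps"
| "singles ((k, Secondary p q) # ps) = singles ps"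

fun halves :: "colored_part list \<Rightarrow> nat list" where
  "halves [] = []"
| "halves ((k, Primary p) # ps) = halves ps"
| "halves ((k, Secondary p q) # ps) =
     ((k - ascents (p # q # word ps) - ascents (q # word ps)) div 2) # halves ps"

lemma word_simps [simp]:
  "word [] = []"
  "word ((k, c) # ps) = color_word c @ word ps"
  by (simp_all add: word_def)

lemma ascents_Cons_le: "ascents (p # w) \<le> length w"
  by (induction w arbitrary: p) (auto intro: le_SucI)

lemma word_interleave:
  "length w = length xs + 2 * length vs \<Longrightarrow> word (interleave w xs vs) = w"
proof (induction w xs vs rule: interleave.induct)
  case (2 w x xs)
  then show ?case by (cases w) auto
next
  case (3 w v vs)
  then show ?case by (cases w rule: ascents.cases) auto
next
  case (4 w x xs v vs)
  then show ?case by (cases w rule: ascents.cases) auto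
qed auto

lemma singles_interleave:
  "length w = length xs + 2 * length vs \<Longrightarrow> singles (interleave w xs vs) = xs"
proof (induction w xs vs rule: interleave.induct)
  case (2 w x xs)
  then show ?case by (cases w) (auto simp: word_interleave)
next
  case (3 w v vs)
  then show ?case by (cases w rule: ascents.cases) auto
next
  case (4 w x xs v vs)
  then show ?case by (cases w rule: ascents.cases) (auto simp: word_interleave)
qed auto

lemma halves_interleave:
  "length w = length xs + 2 * length vs \<Longrightarrow> halves (interleave w xs vs) = vs"
proof (induction w xs vs rule: interleave.induct)
  case (2 w x xs)
  then show ?case by (cases w) auto
next
  case (3 w v vs)
  then show ?case by (cases w rule: ascents.cases) (auto simp: word_interleave)
next
  case (4 w x xs v vs)
  then show ?case by (cases w rule: ascents.cases) (auto simp: word_interleave)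
qed auto

lemma sum_interleave:
  "length w = length xs + 2 * length vs \<Longrightarrow>
   sum_list (map fst (interleave w xs vs)) = sum_list xs + 2 * sum_list vs + ascent_weight w"
proof (induction w xs vs rule: interleave.induct)
  case (2 w x xs)
  then show ?case by (cases w) auto
next
  case (3 w v vs)
  then show ?case by (cases w rule: ascents.cases) auto
next
  case (4 w x xs v vs)
  then show ?case by (cases w rule: ascents.cases) auto
qed auto

text \<open>The conditions on the size of a single part of a partition counted by \<^const>\<open>D_partitions\<close>:
  the part is positive, has the right parity, and is not a secondary part of size \<open>1\<close>.\<close>
definition admissible :: "colored_part \<Rightarrow> bool" where
  "admissible x \<longleftrightarrow> fst x \<ge> 1 \<and> parity_ok x \<and> (fst x = 1 \<longrightarrow> snd x \<in> range Primary)"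

lemma admissible_interleave:
  assumes "length w = length xs + 2 * length vs" "\<forall>x\<in>set xs. x \<ge> 1" "\<forall>v\<in>set vs. v \<ge> 1"
  shows "\<forall>p\<in>set (interleave w xs vs). admissible p"
  using assms
proof (induction w xs vs rule: interleave.induct)
  case (2 w x xs)
  then show ?case by (cases w) (auto simp: admissible_def)
next
  case (3 w v vs)
  then show ?case by (cases w rule: ascents.cases) (auto simp: admissible_def)
next
  case (4 w x xs v vs)
  then show ?case by (cases w rule: ascents.cases) (auto simp: admissible_def)
qed auto

lemma interleave_eq_Nil_iff [simp]: "interleave w xs vs = [] \<longleftrightarrow> xs = [] \<and> vs = []"
  by (cases "(w, xs, vs)" rule: interleave.cases) auto

section \<open>Chains for the difference conditions are interleavings\<close>

text \<open>A condition on two consecutive parts amounts to conditions on the next entries of both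
  sequences.  The comparison made by \<open>interleave\<close> carries the condition over from the entry that
  comes first to the other one.\<close>
lemma Primary_gg_interleave_iff:
  assumes "length w = length xs + 2 * length vs"
  shows "(interleave w xs vs \<noteq> [] \<longrightarrow> (k, Primary c) \<ggreater>\<^sub>c hd (interleave w xs vs)) \<longleftrightarrow>
         (xs \<noteq> [] \<longrightarrow> hd xs + ascents (c # w) < k) \<and>
         (vs \<noteq> [] \<longrightarrow> 2 * hd vs + ascents w + ascents (c # w) \<le> k)"
proof (cases "(w, xs, vs)" rule: interleave.cases)
  case (2 w' x xs')
  then show ?thesis using assms by (cases w) auto
next
  case (3 w' v vs')
  then show ?thesis using assms by (cases w rule: ascents.cases) auto
next
  case (4 w' x xs' v vs')
  then show ?thesis using assms by (cases w rule: ascents.cases) auto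
qed auto

text \<open>Here the parity of \<open>k\<close> matters: the entry of \<open>xs\<close> alone gives the bound on \<open>k\<close> in terms of
  \<open>hd vs\<close> only up to one unit.\<close>
lemma Secondary_gg_interleave_iff:
  assumes "length w = length xs + 2 * length vs" and "k mod 2 = of_bool (c \<le> d)"
  shows "(interleave w xs vs \<noteq> [] \<longrightarrow> (k, Secondary c d) \<ggreater>\<^sub>c hd (interleave w xs vs)) \<longleftrightarrow>
         (xs \<noteq> [] \<longrightarrow> hd xs + ascents (c # d # w) < k) \<and>
         (vs \<noteq> [] \<longrightarrow> 2 * hd vs + ascents (c # d # w) + ascents (d # w) \<le> k)"
proof (cases "(w, xs, vs)" rule: interleave.cases)
  case (2 w' x xs')
  then show ?thesis using assms by (cases w) auto
next
  case (3 w' v vs')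
  then show ?thesis using assms by (cases w rule: ascents.cases) auto
next
  case (4 w' x xs' v vs')
  obtain a b r where w: "w = a # b # r"
    using assms 4 by (cases w rule: ascents.cases) auto
  obtain j where j: "k = 2 * j + of_bool (c \<le> d)"
    using assms(2) by (metis mult_div_mod_eq)
  show ?thesis
  proof (cases "2 * v + ascents (b # r) \<le> x")
    case True
    have "2 * v + ascents (c # d # w) + ascents (d # w) \<le> k" if "x + ascents (c # d # w) < k"
    proof -
      \<comment> \<open>Stated for \<open>j\<close>, so that the bound on \<open>2 * j\<close> is rounded to the next even number.\<close>
      have "v + ascents (d # w) \<le> j"
        using that True unfolding w j by (cases "d \<le> a"; cases "a \<le> b"; simp)
      then show ?thesis by (simp add: j w)
    qed
    moreover have "(k, Secondary c d) \<ggreater>\<^sub>c hd (interleave w xs vs) \<longleftrightarrow> x + ascents (c # d # w) < k"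
      using 4 True w by auto
    ultimately show ?thesis using 4 by auto
  next
    case False
    have "x + ascents (c # d # w) < k" if "2 * v + ascents (c # d # w) + ascents (d # w) \<le> k"
      using that False unfolding w by (cases "d \<le> a"; cases "a \<le> b"; simp)
    moreover have "(k, Secondary c d) \<ggreater>\<^sub>c hd (interleave w xs vs) \<longleftrightarrow>
        2 * v + ascents (c # d # w) + ascents (d # w) \<le> k"
      using 4 False w by auto
    ultimately show ?thesis using 4 by auto
  qed
qed auto

lemma chain_interleave:
  assumes "length w = length xs + 2 * length vs" "sorted_wrt (>) xs" "sorted_wrt (\<ge>) vs"
  shows "successively (\<ggreater>\<^sub>c) (interleave w xs vs)"
  using assms
proof (induction w xs vs rule: interleave.induct)
  case (2 w x xs)
  then obtain c w' where w: "w = c # w'" by (cases w) auto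
  show ?case
    using 2 w Primary_gg_interleave_iff[of w' xs "[]" "x + ascents w" c]
    by (cases xs) (auto simp: successively_Cons)
next
  case (3 w v vs)
  then obtain c d w' where w: "w = c # d # w'" by (cases w rule: ascents.cases) auto
  show ?case
    using 3 w Secondary_gg_interleave_iff[of w' "[]" vs "2 * v + ascents w + ascents (tl w)" c d]
    by (cases vs) (auto simp: successively_Cons)
next
  case (4 w x xs v vs)
  then obtain c d w' where w: "w = c # d # w'" by (cases w rule: ascents.cases) auto
  show ?case
  proof (cases "2 * v + ascents (tl w) \<le> x")
    case True
    then show ?thesis
      using 4 w Primary_gg_interleave_iff[of "d # w'" xs "v # vs" "x + ascents w" c]
      by (cases xs) (auto simp: successively_Cons)
  next
    case False
    then show ?thesis
      using 4 w Secondary_gg_interleave_iff[of w' "x # xs" vs "2 * v + ascents w + ascents (tl w)" c d]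
      by (cases vs) (auto simp: successively_Cons)
  qed
qed auto

lemma interleave_Cons_left:
  assumes "vs \<noteq> [] \<Longrightarrow> 2 * hd vs + ascents (tl w) \<le> x"
  shows "interleave w (x # xs) vs =
         (x + ascents w, Primary (hd w)) # interleave (tl w) xs vs"
  using assms by (cases vs) auto

lemma interleave_Cons_right:
  assumes "xs \<noteq> [] \<Longrightarrow> hd xs < 2 * v + ascents (tl w)"
  shows "interleave w xs (v # vs) =
         (2 * v + ascents w + ascents (tl w), Secondary (hd w) (hd (tl w)))
           # interleave (tl (tl w)) xs vs"
  using assms by (cases xs) auto

lemma length_le_hd:
  assumes "sorted_wrt (>) xs" "\<forall>x\<in>set xs. x \<ge> (1 :: nat)" "xs \<noteq> []"
  shows "length xs \<le> hd xs"
  using assms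
proof (induction xs)
  case (Cons x xs)
  then show ?case by (cases xs) auto
qed auto

lemma sorted_wrt_gr_Cons:
  assumes "sorted_wrt (>) xs" "xs \<noteq> [] \<Longrightarrow> hd xs < (x :: nat)"
  shows "sorted_wrt (>) (x # xs)"
  using assms by (cases xs) auto

lemma sorted_wrt_ge_Cons:
  assumes "sorted_wrt (\<ge>) xs" "xs \<noteq> [] \<Longrightarrow> hd xs \<le> (x :: nat)"
  shows "sorted_wrt (\<ge>) (x # xs)"
  using assms by (cases xs) auto

text \<open>Conversely, by induction from the last part, every chain of admissible parts arises in this
  way.\<close>
lemma chain_eq_interleave:
  assumes "successively (\<ggreater>\<^sub>c) ps" "\<forall>p\<in>set ps. admissible p"
  shows "\<exists>xs vs. length (word ps) = length xs + 2 * length vs \<and>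
           sorted_wrt (>) xs \<and> sorted_wrt (\<ge>) vs \<and>
           (\<forall>x\<in>set xs. x \<ge> 1) \<and> (\<forall>v\<in>set vs. v \<ge> 1) \<and> interleave (word ps) xs vs = ps"
  using assms
proof (induction ps)
  case Nil
  then show ?case by (intro exI[of _ "[]"]) auto
next
  case (Cons p ps)
  define w where "w = word ps"
  from Cons obtain xs vs where len: "length w = length xs + 2 * length vs"
    and xs: "sorted_wrt (>) xs" "\<forall>x\<in>set xs. x \<ge> 1"
    and vs: "sorted_wrt (\<ge>) vs" "\<forall>v\<in>set vs. v \<ge> 1"
    and ps: "interleave w xs vs = ps"
    by (auto simp: successively_Cons w_def)
  obtain k col where p: "p = (k, col)" by (cases p)
  have adm: "admissible (k, col)" using Cons.prems p by auto
  have hd_gg: "interleave w xs vs \<noteq> [] \<longrightarrow> (k, col) \<ggreater>\<^sub>c hd (interleave w xs vs)"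
    using Cons.prems p ps by (auto simp: successively_Cons)
  show ?case
  proof (cases col)
    case (Primary c)
    have bounds: "xs \<noteq> [] \<Longrightarrow> hd xs + ascents (c # w) < k"
      "vs \<noteq> [] \<Longrightarrow> 2 * hd vs + ascents w + ascents (c # w) \<le> k"
      using hd_gg Primary_gg_interleave_iff[OF len] Primary by blast+
    define x where "x = k - ascents (c # w)"
    have k: "k = x + ascents (c # w) \<and> x \<ge> 1"
    proof (cases "xs = [] \<and> vs = []")
      case True
      then show ?thesis using len adm by (auto simp: x_def admissible_def)
    next
      case False
      moreover have "hd vs \<ge> 1" if "vs \<noteq> []" using vs that by auto
      ultimately show ?thesis using bounds by (fastforce simp: x_def)
    qed
    have "interleave (c # w) (x # xs) vs = (k, Primary c) # ps"
      using bounds k ps by (subst interleave_Cons_left) auto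
    then show ?thesis
      using bounds k len xs vs p Primary w_def
      by (intro exI[of _ "x # xs"] exI[of _ vs]) (auto intro!: sorted_wrt_gr_Cons simp del: sorted_wrt.simps)
  next
    case (Secondary c d)
    have par: "k mod 2 = of_bool (c \<le> d)" using adm Secondary by (auto simp: admissible_def)
    have bounds: "xs \<noteq> [] \<Longrightarrow> hd xs + ascents (c # d # w) < k"
      "vs \<noteq> [] \<Longrightarrow> 2 * hd vs + ascents (c # d # w) + ascents (d # w) \<le> k"
      using hd_gg Secondary_gg_interleave_iff[OF len par] Secondary by blast+
    define v where "v = (k - ascents (c # d # w) - ascents (d # w)) div 2"
    obtain j where j: "k = 2 * j + of_bool (c \<le> d)"
      using par by (metis mult_div_mod_eq)
    have v': "v = j - ascents (d # w)"
      by (auto simp: v_def j)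
    have j_gt: "ascents (d # w) < j"
    proof -
      consider "xs = []" "vs = []" | "vs \<noteq> []" | "xs \<noteq> []" "vs = []" by blast
      then show ?thesis
      proof cases
        case 1
        then show ?thesis using len adm Secondary j by (cases j) (auto simp: admissible_def of_bool_def split: if_splits)
      next
        case 2
        moreover have "hd vs \<ge> 1" using vs 2 by auto
        ultimately show ?thesis using bounds j by auto
      next
        case 3
        \<comment> \<open>Only primary parts follow: there are \<open>length w\<close> of them, with strictly decreasing
          positive remainders, so the largest remainder is at least the number of ascents.\<close>
        have "ascents (d # w) \<le> hd xs"
          using ascents_Cons_le[of d w] length_le_hd[OF xs 3(1)] len 3 by simp
        then show ?thesis using bounds j 3 by auto
      qed
    qed
    have k: "k = 2 * v + ascents (c # d # w) + ascents (d # w)" and v: "v \<ge> 1"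
      using j_gt v' j by auto
    have "interleave (c # d # w) xs (v # vs) = (k, Secondary c d) # ps"
      using bounds k ps by (subst interleave_Cons_right) auto
    then show ?thesis
      using bounds k v len xs vs p Secondary w_def
      by (intro exI[of _ xs] exI[of _ "v # vs"]) (auto intro!: sorted_wrt_ge_Cons simp del: sorted_wrt.simps)
  qed
qed

section \<open>Lexicographic chains of primary parts\<close>

text \<open>The strict lexicographic order on primary-colored parts: by size, then by color.  It is false as
  soon as a secondary color occurs.\<close>
fun lex_above :: "colored_part \<Rightarrow> colored_part \<Rightarrow> bool" where
  "lex_above (k, Primary p) (l, Primary q) \<longleftrightarrow> l + of_bool (p \<le> q) \<le> k"
| "lex_above _ _ \<longleftrightarrow> False"

lemma Primary_lex_above_interleave_iff:
  assumes "length w = length ls"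
  shows "(ls \<noteq> [] \<longrightarrow> lex_above (k, Primary c) (hd (interleave w ls []))) \<longleftrightarrow>
         (ls \<noteq> [] \<longrightarrow> hd ls + ascents (c # w) \<le> k)"
  using assms by (cases ls; cases w) auto

lemma lex_chain_interleave:
  assumes "length w = length ls" "sorted_wrt (\<ge>) ls"
  shows "successively lex_above (interleave w ls [])"
  using assms
proof (induction ls arbitrary: w)
  case (Cons l ls)
  then obtain c w' where w: "w = c # w'" by (cases w) auto
  show ?case
    using Cons w Primary_lex_above_interleave_iff[of w' ls "l + ascents w" c]
    by (cases ls) (auto simp: successively_Cons)
qed auto

lemma primary_interleave:
  "\<forall>p\<in>set (interleave w ls []). snd p \<in> range Primary"
  by (induction ls arbitrary: w) auto

lemma lex_chain_eq_interleave:
  assumes "successively lex_above ps" "\<forall>p\<in>set ps. fst p \<ge> 1 \<and> snd p \<in> range Primary"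
  shows "\<exists>ls. length (word ps) = length ls \<and> sorted_wrt (\<ge>) ls \<and>
           (\<forall>l\<in>set ls. l \<ge> 1) \<and> interleave (word ps) ls [] = ps"
  using assms
proof (induction ps)
  case (Cons p ps)
  define w where "w = word ps"
  from Cons obtain ls where len: "length w = length ls"
    and ls: "sorted_wrt (\<ge>) ls" "\<forall>l\<in>set ls. l \<ge> 1"
    and ps: "interleave w ls [] = ps"
    by (auto simp: successively_Cons w_def)
  obtain k c where p: "p = (k, Primary c)" using Cons.prems by (cases p) auto
  have bound: "ls \<noteq> [] \<Longrightarrow> hd ls + ascents (c # w) \<le> k"
    using Primary_lex_above_interleave_iff[OF len, of k c] Cons.prems p ps
    by (cases ls) (auto simp: successively_Cons)
  define l where "l = k - ascents (c # w)"
  have k: "k = l + ascents (c # w) \<and> l \<ge> 1"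
  proof (cases "ls = []")
    case True
    then show ?thesis using len Cons.prems p by (auto simp: l_def)
  next
    case False
    then have "hd ls \<ge> 1" using ls by auto
    then show ?thesis using bound False by (auto simp: l_def)
  qed
  show ?case
    using bound k len ls p ps w_def
    by (intro exI[of _ "l # ls"]) (auto intro!: sorted_wrt_ge_Cons simp del: sorted_wrt.simps)
qed auto

section \<open>Uniqueness of the chain of a partition\<close>

text \<open>Both relations are strict orders, so a multiset of parts can be listed as a chain in at most one
  way.\<close>
lemma gg_c_irrefl: "\<not> p \<ggreater>\<^sub>c p"
  by (cases "(p, p)" rule: gg_c.cases) auto

lemma of_bool_le_trans:
  "(of_bool (p \<le> r) :: int) \<le> of_bool (p \<le> q) + of_bool (q \<le> (r :: nat))"
  by auto

lemma gg_c_trans: "transp (\<ggreater>\<^sub>c)"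
proof
  fix x y z assume xyz: "x \<ggreater>\<^sub>c y" "y \<ggreater>\<^sub>c z"
  have le1: "(of_bool b :: int) \<le> 1" and ge0: "(of_bool b :: int) \<ge> 0" for b by auto
  obtain k b l c j d where eqs: "x = (k, b)" "y = (l, c)" "z = (j, d)"
    by (metis surj_pair)
  show "x \<ggreater>\<^sub>c z"
  proof (cases b; cases c; cases d)
    fix p q r assume cs: "b = Primary p" "c = Primary q" "d = Primary r"
    then show ?thesis using xyz[unfolded eqs cs gg_c.simps] le1[of "p \<le> r"] ge0[of "p \<le> q"] ge0[of "q \<le> r"]
      unfolding eqs cs gg_c.simps by linarith
  next
    fix p q r s assume cs: "b = Primary p" "c = Primary q" "d = Secondary r s"
    then show ?thesis using xyz[unfolded eqs cs gg_c.simps] le1[of "p \<le> r"] ge0[of "p \<le> q"] ge0[of "q \<le> r"]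
      unfolding eqs cs gg_c.simps by linarith
  next
    fix p q r s assume cs: "b = Primary p" "c = Secondary q r" "d = Primary s"
    then show ?thesis
      using xyz[unfolded eqs cs gg_c.simps] of_bool_le_trans[of p s q] of_bool_le_trans[of q s r] ge0[of "q \<le> r"]
      unfolding eqs cs gg_c.simps by linarith
  next
    fix p q r s t assume cs: "b = Primary p" "c = Secondary q r" "d = Secondary s t"
    then show ?thesis
      using xyz[unfolded eqs cs gg_c.simps] of_bool_le_trans[of p s q] of_bool_le_trans[of q s r]
        ge0[of "q \<le> r"] ge0[of "r \<le> s"]
      unfolding eqs cs gg_c.simps by linarith
  next
    fix p q r s assume cs: "b = Secondary p q" "c = Primary r" "d = Primary s"
    then show ?thesis
      using xyz[unfolded eqs cs gg_c.simps] le1[of "q \<le> s"] ge0[of "q \<le> r"] ge0[of "r \<le> s"]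
      unfolding eqs cs gg_c.simps by linarith
  next
    fix p q r s t assume cs: "b = Secondary p q" "c = Primary r" "d = Secondary s t"
    then show ?thesis
      using xyz[unfolded eqs cs gg_c.simps] le1[of "q \<le> s"] of_bool_le_trans[of q s r]
      unfolding eqs cs gg_c.simps by linarith
  next
    fix p q r s t assume cs: "b = Secondary p q" "c = Secondary r s" "d = Primary t"
    then show ?thesis
      using xyz[unfolded eqs cs gg_c.simps] of_bool_le_trans[of q t r] of_bool_le_trans[of r t s]
        ge0[of "q \<le> r"] ge0[of "r \<le> s"]
      unfolding eqs cs gg_c.simps by linarith
  next
    fix p q r s t v assume cs: "b = Secondary p q" "c = Secondary r s" "d = Secondary t v"
    then show ?thesis
      using xyz[unfolded eqs cs gg_c.simps] of_bool_le_trans[of q t r] of_bool_le_trans[of r t s]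
      unfolding eqs cs gg_c.simps by linarith
  qed
qed

lemma lex_above_irrefl: "\<not> lex_above p p"
  by (cases "(p, p)" rule: lex_above.cases) auto

lemma lex_above_trans: "transp lex_above"
proof
  fix x y z assume "lex_above x y" "lex_above y z"
  then show "lex_above x z"
    by (cases "(x, y)" rule: lex_above.cases; cases z rule: prod.exhaust; cases "snd z")
       (auto simp: of_bool_def split: if_splits)
qed

lemma sorted_wrt_strict_unique:
  assumes "transp R" "\<And>x. \<not> R x x" "sorted_wrt R xs" "sorted_wrt R ys" "mset xs = mset ys"
  shows "xs = ys"
  using assms(3-5)
proof (induction xs arbitrary: ys)
  case (Cons x xs)
  obtain y ys' where ys: "ys = y # ys'" using Cons.prems by (cases ys) auto
  have "x = y"
  proof (rule ccontr)
    assume "x \<noteq> y"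
    have "set (x # xs) = set (y # ys')"
      using Cons.prems ys by (metis set_mset_mset)
    then have "R x y" "R y x"
      using Cons.prems ys \<open>x \<noteq> y\<close> by auto
    then show False using assms(1,2) by (meson transpD)
  qed
  then show ?case using Cons ys by auto
qed auto

lemma chain_unique:
  assumes "transp R" "\<And>x. \<not> R x x" "successively R xs" "successively R ys" "mset xs = mset ys"
  shows "xs = ys"
  using sorted_wrt_strict_unique[OF assms(1,2)] assms(3-5) successively_conv_sorted_wrt[OF assms(1)]
  by blast

section \<open>Color counts and partitions in terms of words\<close>

lemma num_parts_eq_count_list_word:
  assumes "\<forall>p\<in>set ps. color_over m (snd p)" "i \<in> {1..m}"
  shows "num_parts (mset ps) ({Primary i} \<union> {Secondary i j | j. j \<in> {1..m} \<and> j \<noteq> i}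
                                     \<union> {Secondary j i | j. j \<in> {1..m} \<and> j \<noteq> i})
            + 2 * num_parts (mset ps) {Secondary i i} = count_list (word ps) i"
  using assms
proof (induction ps)
  case (Cons p ps)
  obtain k c where "p = (k, c)" by (cases p)
  with Cons show ?case
    by (cases c) (auto simp: num_parts_def)
qed (auto simp: num_parts_def)

lemma num_parts_Primary_eq_count_list_word:
  assumes "\<forall>p\<in>set ps. snd p \<in> range Primary"
  shows "num_parts (mset ps) {Primary i} = count_list (word ps) i"
  using assms
proof (induction ps)
  case (Cons p ps)
  obtain k c where "p = (k, Primary c)" using Cons.prems by (cases p) auto
  with Cons show ?case
    by (auto simp: num_parts_def)
qed (auto simp: num_parts_def)

lemma is_partition_mset_iff:
  "is_partition m n (mset ps) \<longleftrightarrow>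
     (\<forall>p\<in>set ps. fst p \<ge> 1 \<and> parity_ok p) \<and> set (word ps) \<subseteq> {1..m} \<and> sum_list (map fst ps) = n"
proof -
  have "(\<forall>p\<in>set ps. color_over m (snd p)) \<longleftrightarrow> set (word ps) \<subseteq> {1..m}"
  proof (induction ps)
    case (Cons p ps)
    obtain k c where "p = (k, c)" by (cases p)
    with Cons show ?case by (cases c) auto
  qed auto
  moreover have "sum_mset (image_mset fst (mset ps)) = sum_list (map fst ps)"
    by (metis mset_map sum_mset_sum_list)
  ultimately show ?thesis
    by (auto simp: is_partition_def is_colored_part_def)
qed

text \<open>The color words over \<open>{1..m}\<close> in which the color \<open>i\<close> occurs \<open>u i\<close> times.\<close>
definition words :: "nat \<Rightarrow> (nat \<Rightarrow> nat) \<Rightarrow> nat list set" where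
  "words m u = {w. set w \<subseteq> {1..m} \<and> (\<forall>i\<in>{1..m}. count_list w i = u i)}"

text \<open>A partition in \<^const>\<open>C_partitions\<close> is encoded by its word and the weakly decreasing sequence of
  its remainders.\<close>
definition C_data :: "nat \<Rightarrow> (nat \<Rightarrow> nat) \<Rightarrow> nat \<Rightarrow> (nat list \<times> nat list) set" where
  "C_data m u n =
     {(w, ls). w \<in> words m u \<and> length w = length ls \<and> sorted_wrt (\<ge>) ls \<and>
        (\<forall>l\<in>set ls. l \<ge> 1) \<and> sum_list ls + ascent_weight w = n}"

text \<open>A partition in \<^const>\<open>D_partitions\<close> is encoded by its word, the remainders of its primary parts
  and half the remainders of its secondary parts.\<close>
definition D_data :: "nat \<Rightarrow> (nat \<Rightarrow> nat) \<Rightarrow> nat \<Rightarrow> (nat list \<times> nat list \<times> nat list) set" where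
  "D_data m u n =
     {(w, xs, vs). w \<in> words m u \<and> length w = length xs + 2 * length vs \<and>
        sorted_wrt (>) xs \<and> sorted_wrt (\<ge>) vs \<and> (\<forall>x\<in>set xs. x \<ge> 1) \<and> (\<forall>v\<in>set vs. v \<ge> 1) \<and>
        sum_list xs + 2 * sum_list vs + ascent_weight w = n}"

section \<open>Splitting a sequence by the parity of multiplicities\<close>

lemma sorted_wrt_ge_iff: "sorted_wrt (\<ge>) ls \<longleftrightarrow> sorted (rev ls)"
  for ls :: "nat list"
  by (simp add: sorted_wrt_rev)

lemma sorted_wrt_ge_unique:
  fixes xs ys :: "nat list"
  assumes "sorted_wrt (\<ge>) xs" "sorted_wrt (\<ge>) ys" "mset xs = mset ys"
  shows "xs = ys"
proof -
  have "sort ys = rev xs" "sort ys = rev ys"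
    using assms by (auto intro!: properties_for_sort simp: sorted_wrt_ge_iff simp del: sorted_wrt_rev)
  then show ?thesis by simp
qed

text \<open>The weakly decreasing enumeration of a multiset.\<close>
definition descending :: "nat multiset \<Rightarrow> nat list" where
  "descending N = rev (sorted_list_of_multiset N)"

lemma descending [simp]: "mset (descending N) = N" "sorted_wrt (\<ge>) (descending N)"
  by (simp_all add: descending_def sorted_wrt_ge_iff)

lemma distinct_iff_count_mset_le_1: "distinct xs \<longleftrightarrow> (\<forall>x. count (mset xs) x \<le> 1)"
proof -
  have "count (mset xs) x = (if x \<in> set xs then 1 else 0) \<longleftrightarrow> count (mset xs) x \<le> 1" for x
  proof (cases "x \<in> set xs")
    case True
    then have "count (mset xs) x \<ge> 1" by (simp add: Suc_le_eq)
    then have "count (mset xs) x = 1 \<longleftrightarrow> count (mset xs) x \<le> 1" by linarith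
    with True show ?thesis by simp
  next
    case False
    then have "count (mset xs) x = 0" by simp
    then show ?thesis using False by (simp only: if_False zero_le refl)
  qed
  then show ?thesis
    by (simp add: distinct_count_atmost_1)
qed

lemma sorted_wrt_gr_descending:
  assumes "\<forall>x. count N x \<le> 1"
  shows "sorted_wrt (>) (descending N)"
proof -
  have "distinct (descending N)"
    using assms by (simp add: distinct_iff_count_mset_le_1)
  then show ?thesis
    by (simp add: descending_def sorted_wrt_rev strict_sorted_iff)
qed

lemma ex_parity_decomposition:
  "\<exists>X V. N = X + V + V \<and> (\<forall>x. count X x \<le> 1)"
proof (induction N)
  case empty
  show ?case by (intro exI[of _ "{#}"]) auto
next
  case (add a N)
  then obtain X V where XV: "N = X + V + V" "\<forall>x. count X x \<le> 1" by blast
  show ?case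
  proof (cases "a \<in># X")
    case True
    have "add_mset a N = (X - {#a#}) + add_mset a V + add_mset a V"
      using True XV(1) by (simp add: multi_member_split)
    moreover have "count (X - {#a#}) x \<le> 1" for x
      using XV(2) by (simp add: le_diff_conv le_SucI)
    ultimately show ?thesis by blast
  next
    case False
    have "add_mset a N = add_mset a X + V + V" using XV(1) by simp
    moreover have "count (add_mset a X) x \<le> 1" for x
      using XV(2) False by (cases "x = a") (auto simp: not_in_iff)
    ultimately show ?thesis by blast
  qed
qed

lemma parity_decomposition_unique:
  assumes "X + V + V = X' + V' + V'" "\<forall>x. count X x \<le> 1" "\<forall>x. count X' x \<le> 1"
  shows "X = X' \<and> V = V'"
proof -
  have *: "count X x = count X' x \<and> count V x = count V' x" for x
  proof -
    have "count X x + 2 * count V x = count X' x + 2 * count V' x"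
      using arg_cong[OF assms(1), of "\<lambda>M. count M x"] by simp
    moreover have "count X x \<le> 1" "count X' x \<le> 1" using assms(2,3) by auto
    ultimately show ?thesis by presburger
  qed
  then show ?thesis by (auto intro: multiset_eqI)
qed

lemma sorted_wrt_gr_distinct: "sorted_wrt (>) (xs :: nat list) \<Longrightarrow> distinct xs"
  by (induction xs) auto

lemma sorted_wrt_gr_imp_ge: "sorted_wrt (>) (xs :: nat list) \<Longrightarrow> sorted_wrt (\<ge>) xs"
  by (induction xs) auto

lemma bij_betw_D_data_C_data:
  "bij_betw (\<lambda>(w, xs, vs). (w, descending (mset xs + mset vs + mset vs))) (D_data m u n) (C_data m u n)"
    (is "bij_betw ?f _ _")
proof (rule bij_betw_imageI)
  show "inj_on ?f (D_data m u n)"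
  proof (rule inj_onI)
    fix z z' assume z: "z \<in> D_data m u n" "z' \<in> D_data m u n" "?f z = ?f z'"
    obtain w xs vs w' xs' vs' where eqs: "z = (w, xs, vs)" "z' = (w', xs', vs')"
      by (cases z rule: prod_cases3, cases z' rule: prod_cases3) blast
    note mem = z(1,2)[unfolded eqs]
    have "descending (mset xs + mset vs + mset vs) = descending (mset xs' + mset vs' + mset vs')"
      using z(3) eqs by simp
    from arg_cong[OF this, of mset]
    have "mset xs + mset vs + mset vs = mset xs' + mset vs' + mset vs'"
      by (simp only: descending(1))
    then have "mset xs = mset xs' \<and> mset vs = mset vs'"
    proof (rule parity_decomposition_unique)
      show "\<forall>x. count (mset xs) x \<le> 1" "\<forall>x. count (mset xs') x \<le> 1"
        using mem sorted_wrt_gr_distinct[of xs] sorted_wrt_gr_distinct[of xs']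
        unfolding distinct_iff_count_mset_le_1[symmetric] by (simp_all add: D_data_def)
    qed
    moreover have "sorted_wrt (\<ge>) xs" "sorted_wrt (\<ge>) xs'"
      using mem by (simp_all add: D_data_def sorted_wrt_gr_imp_ge)
    moreover have "w = w'" using z(3) eqs by simp
    moreover have "sorted_wrt (\<ge>) vs" "sorted_wrt (\<ge>) vs'"
      using mem by (simp_all add: D_data_def)
    ultimately show "z = z'"
      unfolding eqs using sorted_wrt_ge_unique by blast
  qed
  show "?f ` D_data m u n = C_data m u n"
  proof (intro equalityI subsetI)
    fix z assume "z \<in> ?f ` D_data m u n"
    then obtain w xs vs where z: "z = (w, descending (mset xs + mset vs + mset vs))"
      and mem: "(w, xs, vs) \<in> D_data m u n" by auto
    define ls where "ls = descending (mset xs + mset vs + mset vs)"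
    have ls: "mset ls = mset (xs @ vs @ vs)" by (simp add: ls_def)
    show "z \<in> C_data m u n"
      using mem mset_eq_length[OF ls] mset_eq_setD[OF ls] arg_cong[OF ls, of sum_mset]
      unfolding z C_data_def D_data_def ls_def[symmetric]
      by (auto simp: sum_mset_sum_list) (auto simp: ls_def)
  next
    fix z assume "z \<in> C_data m u n"
    then obtain w ls where z: "z = (w, ls)" and mem: "(w, ls) \<in> C_data m u n" by (cases z) auto
    obtain X V where XV: "mset ls = X + V + V" "\<forall>x. count X x \<le> 1"
      using ex_parity_decomposition by blast
    define xs vs where "xs = descending X" and "vs = descending V"
    have ls: "mset ls = mset (xs @ vs @ vs)" by (simp add: XV(1) xs_def vs_def)
    have "(w, xs, vs) \<in> D_data m u n"
      using mem mset_eq_length[OF ls] mset_eq_setD[OF ls] arg_cong[OF ls, of sum_mset]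
        sorted_wrt_gr_descending[OF XV(2)]
      unfolding C_data_def D_data_def
      by (auto simp: sum_mset_sum_list xs_def[symmetric]) (auto simp: vs_def)
    moreover have "descending (mset xs + mset vs + mset vs) = ls"
      using mem by (intro sorted_wrt_ge_unique) (auto simp: ls C_data_def)
    ultimately show "z \<in> ?f ` D_data m u n"
      using z by (auto intro!: image_eqI[of _ _ "(w, xs, vs)"])
  qed
qed

section \<open>The encodings are bijective\<close>

lemma mset_mem_D_partitions_iff:
  "mset ps \<in> D_partitions m u n \<longleftrightarrow>
     (\<forall>p\<in>set ps. admissible p) \<and> word ps \<in> words m u \<and> sum_list (map fst ps) = n \<and>
     (\<exists>xs. mset xs = mset ps \<and> successively (\<ggreater>\<^sub>c) xs)"
proof (cases "is_partition m n (mset ps)")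
  case True
  then have col: "\<forall>p\<in>set ps. color_over m (snd p)"
    by (auto simp: is_partition_def is_colored_part_def)
  have "(\<forall>i\<in>{1..m}. \<forall>j\<in>{1..m}. (1, Secondary i j) \<notin> set ps) \<longleftrightarrow>
        (\<forall>p\<in>set ps. fst p = 1 \<longrightarrow> snd p \<in> range Primary)" (is "?L \<longleftrightarrow> ?R")
  proof
    assume L: ?L
    show ?R
    proof (intro ballI impI)
      fix p assume p: "p \<in> set ps" "fst p = 1"
      obtain k c where kc: "p = (k, c)" by (cases p)
      show "snd p \<in> range Primary"
        using L p kc col by (cases c) auto
    qed
  next
    assume ?R
    then show ?L by force
  qed
  moreover have "(\<forall>i\<in>{1..m}. u i =
            num_parts (mset ps) ({Primary i} \<union> {Secondary i j | j. j \<in> {1..m} \<and> j \<noteq> i}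
                                     \<union> {Secondary j i | j. j \<in> {1..m} \<and> j \<noteq> i})
            + 2 * num_parts (mset ps) {Secondary i i}) \<longleftrightarrow>
        (\<forall>i\<in>{1..m}. count_list (word ps) i = u i)"
    by (intro ball_cong refl, subst num_parts_eq_count_list_word[OF col]) auto
  ultimately have "mset ps \<in> D_partitions m u n \<longleftrightarrow>
      (\<exists>xs. mset xs = mset ps \<and> successively (\<ggreater>\<^sub>c) xs) \<and>
      (\<forall>p\<in>set ps. fst p = 1 \<longrightarrow> snd p \<in> range Primary) \<and>
      (\<forall>i\<in>{1..m}. count_list (word ps) i = u i)"
    using True by (simp only: D_partitions_def mem_Collect_eq set_mset_mset simp_thms)
  then show ?thesis
    using True[unfolded is_partition_mset_iff] unfolding words_def admissible_def by blast
next
  case False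
  then show ?thesis
    by (auto simp: D_partitions_def is_partition_mset_iff words_def admissible_def)
qed

lemma bij_betw_D_data_D_partitions:
  "bij_betw (\<lambda>(w, xs, vs). mset (interleave w xs vs)) (D_data m u n) (D_partitions m u n)"
    (is "bij_betw ?f _ _")
proof (rule bij_betw_imageI)
  show "inj_on ?f (D_data m u n)"
  proof (rule inj_onI)
    fix z z' assume z: "z \<in> D_data m u n" "z' \<in> D_data m u n" "?f z = ?f z'"
    obtain w xs vs w' xs' vs' where eqs: "z = (w, xs, vs)" "z' = (w', xs', vs')"
      by (cases z rule: prod_cases3, cases z' rule: prod_cases3) blast
    note mem = z(1,2)[unfolded eqs]
    have eq: "mset (interleave w xs vs) = mset (interleave w' xs' vs')"
      using z(3) eqs by simp
    have "interleave w xs vs = interleave w' xs' vs'"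
      using mem by (intro chain_unique[OF gg_c_trans gg_c_irrefl _ _ eq] chain_interleave)
        (auto simp: D_data_def)
    then show "z = z'"
      unfolding eqs using mem word_interleave[of w xs vs] word_interleave[of w' xs' vs']
        singles_interleave[of w xs vs] singles_interleave[of w' xs' vs']
        halves_interleave[of w xs vs] halves_interleave[of w' xs' vs']
      by (auto simp: D_data_def)
  qed
  show "?f ` D_data m u n = D_partitions m u n"
  proof (intro equalityI subsetI)
    fix M assume "M \<in> ?f ` D_data m u n"
    then obtain w xs vs where M: "M = mset (interleave w xs vs)"
      and mem: "(w, xs, vs) \<in> D_data m u n" by auto
    then show "M \<in> D_partitions m u n"
      using admissible_interleave[of w xs vs] chain_interleave[of w xs vs]
        word_interleave[of w xs vs] sum_interleave[of w xs vs]
      unfolding M mset_mem_D_partitions_iff by (auto simp: D_data_def)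
  next
    fix M assume M: "M \<in> D_partitions m u n"
    then obtain ps where ps: "M = mset ps" "successively (\<ggreater>\<^sub>c) ps"
      by (auto simp: D_partitions_def)
    note props = M[unfolded ps mset_mem_D_partitions_iff]
    obtain xs vs where *: "length (word ps) = length xs + 2 * length vs"
        "sorted_wrt (>) xs" "sorted_wrt (\<ge>) vs" "\<forall>x\<in>set xs. x \<ge> 1" "\<forall>v\<in>set vs. v \<ge> 1"
        "interleave (word ps) xs vs = ps"
      using chain_eq_interleave[OF ps(2)] props by blast
    have "(word ps, xs, vs) \<in> D_data m u n"
      using * props sum_interleave[of "word ps" xs vs] by (auto simp: D_data_def)
    then show "M \<in> ?f ` D_data m u n"
      using * ps by (auto intro!: image_eqI[of _ _ "(word ps, xs, vs)"])
  qed
qed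

lemma ex_lex_chain:
  assumes "\<forall>x\<in>#M. snd x \<in> range Primary" "\<forall>x. count M x \<le> 1"
  shows "\<exists>ps. mset ps = M \<and> successively lex_above ps"
proof -
  define S where "S = {(k, p). (k, Primary p) \<in># M}"
  define qs where "qs = rev (sorted_list_of_set S)"
  have inj: "inj (map_prod id Primary :: nat \<times> nat \<Rightarrow> _)"
    by (auto intro: prod.inj_map simp: inj_def)
  have "map_prod id Primary ` S = set_mset M"
    using assms(1) by (force simp: S_def)
  moreover from this have "finite S"
    by (metis finite_imageD finite_set_mset inj inj_on_subset subset_UNIV)
  ultimately have "set (map (map_prod id Primary) qs) = set_mset M"
    by (simp add: qs_def)
  moreover have "distinct (map (map_prod id Primary) qs)"
    using inj_on_subset[OF inj subset_UNIV] by (simp add: distinct_map qs_def)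
  moreover have "M = mset_set (set_mset M)"
    using assms(2) by (intro multiset_eqI) (metis count_mset_set(1,3) count_greater_eq_one_iff count_inI finite_set_mset le_antisym)
  ultimately have "mset (map (map_prod id Primary) qs) = M"
    by (metis mset_set_set)
  moreover have "sorted_wrt (>) qs"
    by (simp add: qs_def sorted_wrt_rev)
  then have "sorted_wrt lex_above (map (map_prod id Primary) qs)"
    unfolding sorted_wrt_map by (rule sorted_wrt_mono_rel[rotated]) auto
  ultimately show ?thesis
    using successively_conv_sorted_wrt[OF lex_above_trans] by blast
qed

lemma mset_mem_C_partitions_iff:
  assumes "successively lex_above ps"
  shows "mset ps \<in> C_partitions m u n \<longleftrightarrow>
     (\<forall>p\<in>set ps. fst p \<ge> 1 \<and> snd p \<in> range Primary) \<and> word ps \<in> words m u \<and>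
     sum_list (map fst ps) = n"
proof -
  have "sorted_wrt lex_above ps"
    using assms successively_conv_sorted_wrt[OF lex_above_trans] by blast
  then have "distinct ps"
    by (induction ps) (auto simp: lex_above_irrefl)
  then have "\<forall>x. count (mset ps) x \<le> 1"
    by (simp add: distinct_iff_count_mset_le_1)
  moreover have parity: "parity_ok p" if "snd p \<in> range Primary" for p
    using that by (cases p) auto
  ultimately have "mset ps \<in> C_partitions m u n \<longleftrightarrow>
      is_partition m n (mset ps) \<and> (\<forall>p\<in>set ps. snd p \<in> range Primary) \<and>
      (\<forall>i\<in>{1..m}. count_list (word ps) i = u i)"
    unfolding C_partitions_def using num_parts_Primary_eq_count_list_word[of ps] by auto
  then show ?thesis
    using parity unfolding is_partition_mset_iff words_def by blast
qed

lemma bij_betw_C_data_C_partitions: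
  "bij_betw (\<lambda>(w, ls). mset (interleave w ls [])) (C_data m u n) (C_partitions m u n)"
    (is "bij_betw ?f _ _")
proof (rule bij_betw_imageI)
  show "inj_on ?f (C_data m u n)"
  proof (rule inj_onI)
    fix z z' assume z: "z \<in> C_data m u n" "z' \<in> C_data m u n" "?f z = ?f z'"
    obtain w ls w' ls' where eqs: "z = (w, ls)" "z' = (w', ls')"
      by (cases z, cases z') blast
    note mem = z(1,2)[unfolded eqs]
    have eq: "mset (interleave w ls []) = mset (interleave w' ls' [])"
      using z(3) eqs by simp
    have "interleave w ls [] = interleave w' ls' []"
      using mem by (intro chain_unique[OF lex_above_trans lex_above_irrefl _ _ eq] lex_chain_interleave)
        (auto simp: C_data_def)
    then show "z = z'"
      unfolding eqs using mem word_interleave[of w ls "[]"] word_interleave[of w' ls' "[]"]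
        singles_interleave[of w ls "[]"] singles_interleave[of w' ls' "[]"]
      by (auto simp: C_data_def)
  qed
  show "?f ` C_data m u n = C_partitions m u n"
  proof (intro equalityI subsetI)
    fix M assume "M \<in> ?f ` C_data m u n"
    then obtain w ls where M: "M = mset (interleave w ls [])"
      and mem: "(w, ls) \<in> C_data m u n" by auto
    then have "successively lex_above (interleave w ls [])"
      by (auto simp: C_data_def intro: lex_chain_interleave)
    then show "M \<in> C_partitions m u n"
      using mem admissible_interleave[of w ls "[]"] primary_interleave[of w ls]
        word_interleave[of w ls "[]"] sum_interleave[of w ls "[]"]
      unfolding M by (subst mset_mem_C_partitions_iff) (auto simp: C_data_def admissible_def)
  next
    fix M assume M: "M \<in> C_partitions m u n"
    then obtain ps where ps: "M = mset ps" "successively lex_above ps"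
      using ex_lex_chain[of M] by (auto simp: C_partitions_def)
    note props = M[unfolded ps mset_mem_C_partitions_iff[OF ps(2)]]
    obtain ls where *: "length (word ps) = length ls" "sorted_wrt (\<ge>) ls" "\<forall>l\<in>set ls. l \<ge> 1"
        "interleave (word ps) ls [] = ps"
      using lex_chain_eq_interleave[OF ps(2)] props by blast
    have "(word ps, ls) \<in> C_data m u n"
      using * props sum_interleave[of "word ps" ls "[]"] by (auto simp: C_data_def)
    then show "M \<in> ?f ` C_data m u n"
      using * ps by (auto intro!: image_eqI[of _ _ "(word ps, ls)"])
  qed
qed

theorem theorem1p4:
  fixes m n :: nat and u :: "nat \<Rightarrow> nat"
  assumes "m \<ge> 1"
  shows "card (C_partitions m u n) = card (D_partitions m u n)"
  using bij_betw_same_card[OF bij_betw_C_data_C_partitions]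
    bij_betw_same_card[OF bij_betw_D_data_C_data]
    bij_betw_same_card[OF bij_betw_D_data_D_partitions]
  by metis

end
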